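(* Let $\Gamma$ be any sequent that does not contain occurrences of $[P^*]$ ($P\in\mathrm{PRO}$), and suppose that $\Gamma$ is derivable in $\mathrm{SEQ}_\omega^{\mathrm{PDL}}$. Then $\Gamma$ is derivable in the subsystem $\mathrm{SEQ}_1^{\mathrm{PDL}}$ of $\mathrm{SEQ}_\omega^{\mathrm{PDL}}$ that does not contain the inferences $[*]$ and (Cut); every derivation in $\mathrm{SEQ}_1^{\mathrm{PDL}}$ is finite. Consequently, any given $[P^*]$-free formula is valid in $\mathbf{PDL}$ if and only if it is derivable in $\mathrm{SEQ}_1^{\mathrm{PDL}}$.
   Context: **Syntax.** Programs ($\mathrm{PRO}$, denoted $P,Q,R$) are generated from program variables $\pi_0,\pi_1,\dots$ by $P;Q$, $P\cup Q$, $P^*$. Formulas (seq-formulas) are built from literals $x,\neg x$ ($x$ a formula variable) by $\vee$, $\wedge$ and the modal operations $[P]A$, $\langle P\rangle A$ for $P\in\mathrm{PRO}$. The negation $\overline F$ is defined by $\overline{x}=\neg x$, $\overline{\neg x}=x$, $\overline{A\vee B}=\overline A\wedge\overline B$, $\overline{A\wedge B}=\overline A\vee\overline B$, $\overline{\langle P\rangle A}=[P]\overline A$, $\overline{[P]A}=\langle P\rangle\overline A$. Write $\langle P\rangle^m$, $[P]^m$ for $m$-fold iteration; for $\chi\in\{0,1\}$ let $(P)_\chi=[P]$ if $\chi=1$ and $(P)_\chi=\langle P\rangle$ if $\chi=0$. For a finite (possibly empty) list $\overrightarrow Q=Q_1,\dots,Q_k$ of programs, $\langle\overrightarrow Q\rangle=\langle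 Q_1\rangle\cdots\langle Q_k\rangle$ and $[\overrightarrow Q]=[Q_1]\cdots[Q_k]$. Sequents are finite multisets of formulas; commas denote multiset union. **Semantics.** In a Kripke model each atomic program is interpreted by a binary relation on states; $;$ is composition, $\cup$ union, ${}^*$ reflexive-transitive closure; $[P]A$ (resp. $\langle P\rangle A$) holds at $u$ iff $A$ holds at all (resp. some) $v$ with $u\,R_P\,v$. A formula is valid in $\mathbf{PDL}$ iff it holds at all states of all Kripke models; a sequent is valid iff the disjunction of its formulas is. **The calculus $\mathrm{SEQ}_\omega^{\mathrm{PDL}}$.** Axiom (Ax): $x,\neg x,\Gamma$. Rules (premises $\Rightarrow$ conclusion): - $(\vee)$: $A,B,\Gamma\Rightarrow A\vee B,\Gamma$. $(\wedge)$: $A,\Gamma$ and $B,\Gamma\Rightarrow A\wedge B,\Gamma$. - $\langle\cup\rangle$: $\langle P\rangle A,\langle R\rangle A,\Gamma\Rightarrow\langle P\cup R\rangle A,\Gamma$. $[\cup]$: $[P]A,\Gamma$ and $[R]A,\Gamma\Rightarrow[P\cup R]A,\Gamma$. - $\langle;\rangle$: $\langle P\rangle\langle R\rangle A,\Gamma\Rightarrow\langle P;R\rangle A,\Gamma$. $[;]$: $[P][R]A,\Gamma\Rightarrow[P;R]A,\Gamma$. - $\langle*\rangle$: $\langle\overrightarrow Q\rangle\langle P\rangle^mA,\langle\overrightarrow Q\rangle\langle P^*\rangle A,\Gamma\Rightarrow\langle\overrightarrow Q\rangle\langle P^*\rangle A,\Gamma$ (any $m\ge0$). - $[*]$ (the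 $\omega$-rule): $[\overrightarrow Q][P]^mA,\Gamma$ for all $m\ge0$ $\Rightarrow[\overrightarrow Q][P^*]A,\Gamma$. - (Gen): $A_1,\dots,A_n\Rightarrow(P)_{\chi_1}A_1,\dots,(P)_{\chi_n}A_n,\Gamma$, where $n>0$ and $\sum_{i=1}^n\chi_i=1$. - (Cut): $C,\Gamma$ and $\overline C,\Pi\Rightarrow\Gamma\cup\Pi$. Derivations are well-founded (possibly infinite) trees whose nodes are supplied with ordinals such that ordinals of premises are smaller than those of the corresponding conclusions. $\mathrm{SEQ}_1^{\mathrm{PDL}}$ is $\mathrm{SEQ}_\omega^{\mathrm{PDL}}$ without the rules $[*]$ and (Cut).
   Formalization: "[P*]-free" is taken to mean that no star occurs anywhere in the program of a box; excluding only literal occurrences of [P*] makes the claim false, e.g. for the sequent [p∪p*]x, ¬x, ⟨p*⟩(x∧⟨p⟩¬x). *)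

theory Defs
  imports "HOL-Library.Multiset" "HOL-Library.Infinite_Typeclass"
begin

section \<open>Syntax\<close>

datatype prog =
    Atom nat
  | Comp prog prog
  | Choice prog prog
  | Star prog

text \<open>Formulas are in negation normal form: \<^term>\<open>PosLit\<close> and \<^term>\<open>NegLit\<close> are the two kinds of literals,
  and negation is an operation on formulas.\<close>

datatype fml =
    PosLit nat
  | NegLit nat
  | Or fml fml
  | And fml fml
  | Box prog fml
  | Dia prog fml

primrec neg :: "fml \<Rightarrow> fml" where
  "neg (PosLit x) = NegLit x"
| "neg (NegLit x) = PosLit x"
| "neg (Or A B) = And (neg A) (neg B)"
| "neg (And A B) = Or (neg A) (neg B)"
| "neg (Dia P A) = Box P (neg A)"
| "neg (Box P A) = Dia P (neg A)"

definition modal :: "prog \<Rightarrow> nat \<Rightarrow> fml \<Rightarrow> fml" where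
  "modal P \<chi> A = (if \<chi> = 1 then Box P A else Dia P A)"

abbreviation boxes :: "prog list \<Rightarrow> fml \<Rightarrow> fml" where
  "boxes Qs A \<equiv> foldr Box Qs A"

abbreviation dias :: "prog list \<Rightarrow> fml \<Rightarrow> fml" where
  "dias Qs A \<equiv> foldr Dia Qs A"

type_synonym sequent = "fml multiset"

primrec star_free :: "prog \<Rightarrow> bool" where
  "star_free (Atom i) \<longleftrightarrow> True"
| "star_free (Comp P Q) \<longleftrightarrow> star_free P \<and> star_free Q"
| "star_free (Choice P Q) \<longleftrightarrow> star_free P \<and> star_free Q"
| "star_free (Star P) \<longleftrightarrow> False"

text \<open>
  A formula is free of \<open>[P\<^sup>*]\<close> if no star occurs in the program of any box.  It is not enough to forbid
  subformulas \<^term>\<open>Box (Star P) A\<close>: the formula \<open>[Q \<union> P\<^sup>*]A\<close> contains \<open>[P\<^sup>*]A\<close> implicitly, as the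
  rules for \<open>[\<union>]\<close> and \<open>[;]\<close> produce it.  Stars in diamonds are unrestricted.
\<close>

primrec box_star_free :: "fml \<Rightarrow> bool" where
  "box_star_free (PosLit x) \<longleftrightarrow> True"
| "box_star_free (NegLit x) \<longleftrightarrow> True"
| "box_star_free (Or A B) \<longleftrightarrow> box_star_free A \<and> box_star_free B"
| "box_star_free (And A B) \<longleftrightarrow> box_star_free A \<and> box_star_free B"
| "box_star_free (Box P A) \<longleftrightarrow> star_free P \<and> box_star_free A"
| "box_star_free (Dia P A) \<longleftrightarrow> box_star_free A"


section \<open>Kripke semantics\<close>

record 'w kripke =
  states :: "'w set"
  acc :: "nat \<Rightarrow> ('w \<times> 'w) set"
  val :: "nat \<Rightarrow> 'w set"

definition kripke_model :: "'w kripke \<Rightarrow> bool" where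
  "kripke_model M \<longleftrightarrow> states M \<noteq> {} \<and>
     (\<forall>i. acc M i \<subseteq> states M \<times> states M) \<and> (\<forall>x. val M x \<subseteq> states M)"

text \<open>The closure \<open>\<^sup>*\<close> of \<^theory>\<open>HOL.Transitive_Closure\<close> is reflexive on the whole type, but from a state of a
  model it only reaches states of that model.\<close>

primrec prog_rel :: "'w kripke \<Rightarrow> prog \<Rightarrow> ('w \<times> 'w) set" where
  "prog_rel M (Atom i) = acc M i"
| "prog_rel M (Comp P Q) = prog_rel M P O prog_rel M Q"
| "prog_rel M (Choice P Q) = prog_rel M P \<union> prog_rel M Q"
| "prog_rel M (Star P) = (prog_rel M P)\<^sup>*"

primrec holds :: "'w kripke \<Rightarrow> 'w \<Rightarrow> fml \<Rightarrow> bool" where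
  "holds M u (PosLit x) \<longleftrightarrow> u \<in> val M x"
| "holds M u (NegLit x) \<longleftrightarrow> u \<notin> val M x"
| "holds M u (Or A B) \<longleftrightarrow> holds M u A \<or> holds M u B"
| "holds M u (And A B) \<longleftrightarrow> holds M u A \<and> holds M u B"
| "holds M u (Box P A) \<longleftrightarrow> (\<forall>v. (u, v) \<in> prog_rel M P \<longrightarrow> holds M v A)"
| "holds M u (Dia P A) \<longleftrightarrow> (\<exists>v. (u, v) \<in> prog_rel M P \<and> holds M v A)"

text \<open>
  HOL cannot quantify over types inside a formula, so validity is relative to a type \<open>'w\<close> from which
  the states are drawn.  The state set of a model is an arbitrary nonempty subset of \<open>'w\<close>, and \<open>'w\<close>
  ranges over all infinite types, so a theorem polymorphic in \<open>'w\<close> covers the finite models and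
  models of every cardinality.
\<close>

definition valid :: "'w::infinite itself \<Rightarrow> fml \<Rightarrow> bool" where
  "valid _ A \<longleftrightarrow> (\<forall>M :: 'w kripke. kripke_model M \<longrightarrow> (\<forall>u \<in> states M. holds M u A))"


section \<open>The sequent calculi\<close>

datatype rule =
    Ax | OrR | AndR | DiaChoice | BoxChoice | DiaComp | BoxComp | DiaStar | BoxStar | Gen | Cut

text \<open>\<open>inference r p \<Gamma>\<close>: the rule \<open>r\<close> leads from the premises \<open>p\<close> to the conclusion \<open>\<Gamma>\<close>.  The premises
  are a partial function on \<open>nat\<close>, total in the case of the \<open>\<omega>\<close>-rule.\<close>

inductive inference :: "rule \<Rightarrow> (nat \<rightharpoonup> sequent) \<Rightarrow> sequent \<Rightarrow> bool" where
  Ax: "inference Ax Map.empty ({#PosLit x, NegLit x#} + \<Gamma>)"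
| OrR: "inference OrR [0 \<mapsto> {#A, B#} + \<Gamma>] ({#Or A B#} + \<Gamma>)"
| AndR: "inference AndR [0 \<mapsto> {#A#} + \<Gamma>, 1 \<mapsto> {#B#} + \<Gamma>] ({#And A B#} + \<Gamma>)"
| DiaChoice: "inference DiaChoice [0 \<mapsto> {#Dia P A, Dia R A#} + \<Gamma>] ({#Dia (Choice P R) A#} + \<Gamma>)"
| BoxChoice: "inference BoxChoice [0 \<mapsto> {#Box P A#} + \<Gamma>, 1 \<mapsto> {#Box R A#} + \<Gamma>]
    ({#Box (Choice P R) A#} + \<Gamma>)"
| DiaComp: "inference DiaComp [0 \<mapsto> {#Dia P (Dia R A)#} + \<Gamma>] ({#Dia (Comp P R) A#} + \<Gamma>)"
| BoxComp: "inference BoxComp [0 \<mapsto> {#Box P (Box R A)#} + \<Gamma>] ({#Box (Comp P R) A#} + \<Gamma>)"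
| DiaStar: "inference DiaStar
    [0 \<mapsto> {#dias Qs ((Dia P ^^ m) A), dias Qs (Dia (Star P) A)#} + \<Gamma>]
    ({#dias Qs (Dia (Star P) A)#} + \<Gamma>)"
| BoxStar: "inference BoxStar
    (\<lambda>m. Some ({#boxes Qs ((Box P ^^ m) A)#} + \<Gamma>))
    ({#boxes Qs (Box (Star P) A)#} + \<Gamma>)"
| Gen: "As \<noteq> [] \<Longrightarrow> length \<chi>s = length As \<Longrightarrow> set \<chi>s \<subseteq> {0, 1} \<Longrightarrow> sum_list \<chi>s = 1 \<Longrightarrow>
    inference Gen [0 \<mapsto> mset As] (mset (map2 (modal P) \<chi>s As) + \<Gamma>)"
| Cut: "inference Cut [0 \<mapsto> {#C#} + \<Gamma>, 1 \<mapsto> {#neg C#} + \<Pi>] (\<Gamma> + \<Pi>)"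

text \<open>A calculus is given by the set of its rules.\<close>

definition SEQ_omega :: "rule set" where
  "SEQ_omega = UNIV"

definition SEQ_1 :: "rule set" where
  "SEQ_1 = SEQ_omega - {BoxStar, Cut}"

text \<open>
  Elements of the following datatype are well-founded, possibly infinitely branching trees.  An
  assignment of ordinals to nodes that decreases towards the premises exists for a tree precisely
  when it is well-founded, so no ordinals are recorded.
\<close>

datatype tree = Infer (endsequent: sequent) (subtrees: "nat \<Rightarrow> tree option")

inductive derivation :: "rule set \<Rightarrow> tree \<Rightarrow> bool" for S where
  "derivation S (Infer \<Gamma> p)"
  if "r \<in> S" "inference r (map_option endsequent \<circ> p) \<Gamma>" "\<forall>i t. p i = Some t \<longrightarrow> derivation S t"

definition derivable :: "rule set \<Rightarrow> sequent \<Rightarrow> bool" where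
  "derivable S \<Gamma> \<longleftrightarrow> (\<exists>t. derivation S t \<and> endsequent t = \<Gamma>)"

text \<open>A node is identified with the path leading to it from the root.\<close>

inductive is_node :: "tree \<Rightarrow> nat list \<Rightarrow> bool" where
  "is_node t []"
| "subtrees t i = Some t' \<Longrightarrow> is_node t' ns \<Longrightarrow> is_node t (i # ns)"

definition finite_tree :: "tree \<Rightarrow> bool" where
  "finite_tree t \<longleftrightarrow> finite {ns. is_node t ns}"

end

(*
  Every rule is sound, so it suffices to show that SEQ_1 is complete for box-star-free sequents.
  Contraction is admissible in a subsystem G3 of SEQ_1, hence an underivable sequent extends to a
  maximal set no finite multiset over which is derivable.  Such sets label the worlds of a tree
  model in which every box-star-free formula of a label is false: a false diamond of a star is
  unfolded into all its finite iterations, and boxes, being star-free, reduce to atomic boxes, each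
  of which receives a successor witnessing its falsity through (Gen).
*)

theory Submission imports Defs "HOL-Library.Countable" begin

section \<open>Soundness\<close>

lemma holds_neg [simp]: "holds M u (neg A) \<longleftrightarrow> \<not> holds M u A"
  by (induction A arbitrary: u) auto

text \<open>The relation of a starred program is reflexive on the whole type, so only pairs that
  start at a state are sure to stay inside the model.\<close>

lemma prog_rel_states:
  assumes "kripke_model M" "(u, v) \<in> prog_rel M P" "u \<in> states M"
  shows "v \<in> states M"
  using assms(2,3)
proof (induction P arbitrary: u v)
  case (Atom i)
  then show ?case using assms(1) by (auto simp: kripke_model_def)
next
  case (Star P)
  from Star.prems(1) have "(u, v) \<in> (prog_rel M P)\<^sup>*" by simp
  then show ?case using Star.prems(2) by induction (auto intro: Star.IH)
qed auto

text \<open>An iterated modality has its extra operator in front, so powers are split at the first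
  step; \<open>relpow.simps\<close> splits at the last.\<close>

lemma relpow_Suc_left: "r ^^ Suc m = r O r ^^ m"
  by (simp add: relpow_commute)

lemma holds_Dia_pow: "holds M u ((Dia P ^^ m) A) \<longleftrightarrow> (\<exists>v. (u, v) \<in> prog_rel M P ^^ m \<and> holds M v A)"
  by (induction m arbitrary: u) (simp, simp add: relpow_Suc_left relcomp_unfold del: relpow.simps(2), blast)

lemma holds_Box_pow: "holds M u ((Box P ^^ m) A) \<longleftrightarrow> (\<forall>v. (u, v) \<in> prog_rel M P ^^ m \<longrightarrow> holds M v A)"
  by (induction m arbitrary: u) (simp, simp add: relpow_Suc_left relcomp_unfold del: relpow.simps(2), blast)

lemma holds_dias_mono:
  "holds M u (dias Qs A) \<Longrightarrow> (\<And>v. holds M v A \<Longrightarrow> holds M v B) \<Longrightarrow> holds M u (dias Qs B)"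
  by (induction Qs arbitrary: u) auto

text \<open>Boxes commute with infinite conjunctions, which makes the \<omega>-rule sound below a
  prefix of boxes.\<close>

lemma holds_boxes_all:
  "(\<And>m. holds M u (boxes Qs (A m))) \<Longrightarrow> (\<And>v. (\<And>m. holds M v (A m)) \<Longrightarrow> holds M v B)
    \<Longrightarrow> holds M u (boxes Qs B)"
  by (induction Qs arbitrary: u) auto

text \<open>Premises are assumed true at all states, not only at \<open>u\<close>, because (Gen)
  moves to a successor of \<open>u\<close>.\<close>

lemma inference_sound:
  assumes "inference r p \<Gamma>" and M: "kripke_model M" and u: "u \<in> states M"
    and prems: "\<And>i \<Delta> v. p i = Some \<Delta> \<Longrightarrow> v \<in> states M \<Longrightarrow> \<exists>A\<in>#\<Delta>. holds M v A"
  shows "\<exists>A\<in>#\<Gamma>. holds M u A"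
proof -
  have prems: "pred_option (\<lambda>\<Delta>. \<forall>v\<in>states M. \<exists>A\<in>#\<Delta>. holds M v A) (p i)" for i
    using prems by (cases "p i") auto
  from assms(1) show ?thesis
  proof cases
    case (DiaStar Qs P m A \<Gamma>')
    have "\<exists>B\<in>#{#dias Qs ((Dia P ^^ m) A), dias Qs (Dia (Star P) A)#} + \<Gamma>'. holds M u B"
      using prems[of 0] u DiaStar by simp
    moreover have "holds M v ((Dia P ^^ m) A) \<Longrightarrow> holds M v (Dia (Star P) A)" for v
      by (auto simp: holds_Dia_pow dest: relpow_imp_rtrancl)
    ultimately show ?thesis using DiaStar holds_dias_mono by fastforce
  next
    case (BoxStar Qs P A \<Gamma>')
    have "\<exists>B\<in>#{#boxes Qs ((Box P ^^ m) A)#} + \<Gamma>'. holds M u B" for m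
      using prems[of m] u BoxStar by simp
    moreover have "(\<And>m. holds M v ((Box P ^^ m) A)) \<Longrightarrow> holds M v (Box (Star P) A)" for v
      by (auto simp: holds_Box_pow rtrancl_power)
    ultimately show ?thesis
      using holds_boxes_all[of M u Qs "\<lambda>m. (Box P ^^ m) A" "Box (Star P) A"] BoxStar
      by fastforce
  next
    case (Gen As \<chi>s P \<Gamma>')
    have "sum_list \<chi>s \<noteq> 0" using Gen by simp
    then have "\<exists>x\<in>set \<chi>s. x \<noteq> 0" by simp
    moreover have "set \<chi>s \<subseteq> {0, 1}" by fact
    ultimately have "1 \<in> set \<chi>s" by auto
    then obtain j where j: "j < length \<chi>s" "\<chi>s ! j = 1" by (auto simp: in_set_conv_nth)
    have mem: "modal P (\<chi>s ! i) (As ! i) \<in># \<Gamma>" if "i < length As" for i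
      using that Gen nth_mem[of i "map2 (modal P) \<chi>s As"] by simp
    show ?thesis
    proof (cases "holds M u (Box P (As ! j))")
      case True
      then have "holds M u (modal P (\<chi>s ! j) (As ! j))" using j by (simp add: modal_def)
      moreover have "modal P (\<chi>s ! j) (As ! j) \<in># \<Gamma>" using mem j(1) Gen(5) by auto
      ultimately show ?thesis by blast
    next
      case False
      \<comment> \<open>The state \<open>v\<close> refutes the boxed formula. The premise makes some
        \<open>As ! i\<close> true at \<open>v\<close>; this \<open>i\<close> differs from
        \<open>j\<close>, so it carries a diamond, witnessed by \<open>v\<close>.\<close>
      then obtain v where v: "(u, v) \<in> prog_rel M P" "\<not> holds M v (As ! j)" by auto
      have "v \<in> states M" using prog_rel_states[OF M v(1) u] .
      moreover have "\<forall>v\<in>states M. \<exists>A\<in>set As. holds M v A" using prems[of 0] Gen(2) by simp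
      ultimately obtain i where i: "i < length As" "holds M v (As ! i)"
        by (metis in_set_conv_nth)
      \<comment> \<open>A second index with value 1 would make the sum at least 2.\<close>
      have "\<chi>s ! i \<noteq> 1"
      proof
        assume "\<chi>s ! i = 1"
        moreover have "i \<noteq> j" using i v by auto
        ultimately have "(\<Sum>k\<in>{i, j}. \<chi>s ! k) = 2" using j by simp
        moreover have "(\<Sum>k\<in>{i, j}. \<chi>s ! k) \<le> (\<Sum>k = 0..<length \<chi>s. \<chi>s ! k)"
          using i j Gen(5) by (intro sum_mono2) auto
        ultimately show False using Gen(7) by (simp add: sum_list_sum_nth)
      qed
      then have "holds M u (modal P (\<chi>s ! i) (As ! i))" using v i by (auto simp: modal_def)
      then show ?thesis using mem i by blast
    qed
  qed (use prems[of 0] prems[of 1] u in \<open>auto 0 4 simp: relcomp_unfold split: if_splits\<close>)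
qed

lemma derivation_sound:
  assumes "derivation S t" "kripke_model M" "u \<in> states M"
  shows "\<exists>A\<in>#endsequent t. holds M u A"
  using assms(1,3)
proof (induction arbitrary: u)
  case (1 r p \<Gamma>)
  show ?case
    using inference_sound[OF 1(2) assms(2) 1(4)] 1(3) by fastforce
qed

section \<open>Finiteness of derivations\<close>

lemma inference_premises_finite:
  assumes "inference r p \<Gamma>" "r \<noteq> BoxStar"
  shows "finite (dom p)"
  using assms by cases auto

lemma nodes_Infer: "{ns. is_node (Infer \<Gamma> p) ns} =
  insert [] (\<Union>i\<in>dom p. (#) i ` {ns. is_node (the (p i)) ns})"
  by (auto elim!: is_node.cases[of "Infer \<Gamma> p"] intro: is_node.intros simp: image_iff)

text \<open>Only the \<omega>-rule has infinitely many premises, so at each inference the node set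
  is a finite union of finite sets.\<close>

lemma derivation_finite:
  assumes "derivation S t" "BoxStar \<notin> S"
  shows "finite_tree t"
  using assms(1)
proof induction
  case (1 r p \<Gamma>)
  have "finite (dom (map_option endsequent \<circ> p))"
    using 1 assms(2) inference_premises_finite by metis
  then have "finite (dom p)" by simp
  then show ?case using 1 by (auto simp: finite_tree_def nodes_Infer)
qed

lemma derivable_inference:
  assumes "inference r p \<Gamma>" "r \<in> S" "\<And>i \<Delta>. p i = Some \<Delta> \<Longrightarrow> derivable S \<Delta>"
  shows "derivable S \<Gamma>"
proof -
  \<comment> \<open>The case \<open>None\<close> matters too: the tree must have no subtree where
    \<open>p\<close> has no premise.\<close>
  have "\<forall>i. \<exists>t. (p i = None \<longrightarrow> t = None) \<and>
      (\<forall>\<Delta>. p i = Some \<Delta> \<longrightarrow> (\<exists>t'. t = Some t' \<and> derivation S t' \<and> endsequent t' = \<Delta>))"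
    using assms(3) by (metis derivable_def option.distinct(1) option.exhaust option.inject)
  then obtain q where q: "\<And>i. p i = None \<Longrightarrow> q i = None"
    "\<And>i \<Delta>. p i = Some \<Delta> \<Longrightarrow> \<exists>t'. q i = Some t' \<and> derivation S t' \<and> endsequent t' = \<Delta>"
    by metis
  have "map_option endsequent \<circ> q = p"
  proof
    fix i show "(map_option endsequent \<circ> q) i = p i"
      using q[of i] by (cases "p i") auto
  qed
  moreover have "\<forall>i t. q i = Some t \<longrightarrow> derivation S t"
    using q by (metis option.distinct(1) option.exhaust option.inject)
  ultimately have "derivation S (Infer \<Gamma> q)"
    using assms(1,2) by (auto intro: derivation.intros)
  then show ?thesis by (auto simp: derivable_def)
qed

section \<open>A subsystem with admissible contraction\<close>

text \<open>The two premises of the invertible rule for a formula; a rule with one premise lists it twice.\<close>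

fun dec :: "fml \<Rightarrow> (sequent \<times> sequent) option" where
  "dec (Or A B) = Some ({#A, B#}, {#A, B#})"
| "dec (And A B) = Some ({#A#}, {#B#})"
| "dec (Dia (Choice P R) A) = Some ({#Dia P A, Dia R A#}, {#Dia P A, Dia R A#})"
| "dec (Box (Choice P R) A) = Some ({#Box P A#}, {#Box R A#})"
| "dec (Dia (Comp P R) A) = Some ({#Dia P (Dia R A)#}, {#Dia P (Dia R A)#})"
| "dec (Box (Comp P R) A) = Some ({#Box P (Box R A)#}, {#Box P (Box R A)#})"
| "dec _ = None"

text \<open>Compared with SEQ_1, (Gen) is restricted to atomic programs and the star rule to an empty prefix
  of diamonds.  Otherwise the decomposable formulas could be principal there too, and inversion would
  not preserve the height, on which the admissibility of contraction depends.\<close>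

inductive G3 :: "nat \<Rightarrow> sequent \<Rightarrow> bool" where
  Ax: "PosLit x \<in># \<Gamma> \<Longrightarrow> NegLit x \<in># \<Gamma> \<Longrightarrow> G3 n \<Gamma>"
| Dec: "dec F = Some (\<Delta>, \<Delta>') \<Longrightarrow> G3 n (\<Delta> + \<Gamma>) \<Longrightarrow> G3 n (\<Delta>' + \<Gamma>) \<Longrightarrow> G3 (Suc n) (add_mset F \<Gamma>)"
| Star: "G3 n (add_mset ((Dia P ^^ m) A) (add_mset (Dia (Star P) A) \<Gamma>)) \<Longrightarrow>
    G3 (Suc n) (add_mset (Dia (Star P) A) \<Gamma>)"
| Gen: "G3 n (add_mset B As) \<Longrightarrow>
    add_mset (Box (Atom a) B) (image_mset (Dia (Atom a)) As) \<subseteq># \<Gamma> \<Longrightarrow> G3 (Suc n) \<Gamma>"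

section \<open>Structural rules of \<open>G3\<close>\<close>

lemma G3_Suc: "G3 n \<Gamma> \<Longrightarrow> G3 (Suc n) \<Gamma>"
  by (induction rule: G3.induct) (auto intro: G3.intros)

text \<open>The index only bounds the height from above, so derivations of two premises can be given
  a common index.\<close>

lemma G3_mono: "n \<le> m \<Longrightarrow> G3 n \<Gamma> \<Longrightarrow> G3 m \<Gamma>"
  by (induction rule: dec_induct) (auto intro: G3_Suc)

lemma G3_weaken: "G3 n \<Gamma> \<Longrightarrow> G3 n (\<Gamma> + \<Pi>)"
proof (induction rule: G3.induct)
  case (Dec F \<Delta> \<Delta>' n \<Gamma>)
  then show ?case using G3.Dec[OF Dec(1), of n "\<Gamma> + \<Pi>"] by (simp add: ac_simps)
next
  case (Star n P m A \<Gamma>)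
  then show ?case using G3.Star[of n m P A "\<Gamma> + \<Pi>"] by simp
next
  case (Gen n B As a \<Gamma>)
  then show ?case
    by (meson G3.Gen mset_subset_eq_add_left subset_mset.order_trans)
qed (auto intro: G3.intros)

text \<open>A formula decomposed by \<open>dec\<close> is never principal in an axiom, a star step
  or (Gen); there it belongs to the context and can be replaced. In its own \<open>Dec\<close> step
  the premises are already what is wanted.\<close>

lemma G3_invert:
  assumes "G3 n \<Sigma>" "\<Sigma> = add_mset F \<Gamma>" "dec F = Some (\<Delta>, \<Delta>')"
  shows "G3 n (\<Delta> + \<Gamma>) \<and> G3 n (\<Delta>' + \<Gamma>)"
  using assms(1,2)
proof (induction arbitrary: \<Gamma> rule: G3.induct)
  case (Ax x \<Sigma> n)
  have "F \<noteq> PosLit x" "F \<noteq> NegLit x" using assms(3) by auto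
  then show ?case using Ax by (auto intro!: G3.Ax[of x])
next
  case (Dec F1 \<Delta>1 \<Delta>1' n \<Gamma>1)
  show ?case
  proof (cases "F1 = F")
    case True
    then show ?thesis using Dec assms(3) G3_Suc by auto
  next
    case False
    then obtain K where K: "\<Gamma>1 = add_mset F K" "\<Gamma> = add_mset F1 K"
      using Dec(6) by (auto simp: add_eq_conv_ex)
    have "G3 n (\<Delta> + (\<Delta>1 + K)) \<and> G3 n (\<Delta>' + (\<Delta>1 + K))"
      and "G3 n (\<Delta> + (\<Delta>1' + K)) \<and> G3 n (\<Delta>' + (\<Delta>1' + K))"
      using Dec.IH K by auto
    then show ?thesis
      using G3.Dec[OF Dec(1), of n "\<Delta> + K"] G3.Dec[OF Dec(1), of n "\<Delta>' + K"] K
      by (simp add: ac_simps)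
  qed
next
  case (Star n P m A \<Gamma>1)
  have "F \<noteq> Dia (Star P) A" using assms(3) by auto
  then obtain K where K: "\<Gamma>1 = add_mset F K" "\<Gamma> = add_mset (Dia (Star P) A) K"
    using Star(3) by (auto simp: add_eq_conv_ex)
  have "G3 n (\<Delta> + add_mset ((Dia P ^^ m) A) (add_mset (Dia (Star P) A) K)) \<and>
      G3 n (\<Delta>' + add_mset ((Dia P ^^ m) A) (add_mset (Dia (Star P) A) K))"
    using Star.IH K by (simp add: add_mset_commute)
  then show ?case
    using G3.Star[of n m P A "\<Delta> + K"] G3.Star[of n m P A "\<Delta>' + K"] K by simp
next
  case (Gen n B As a \<Sigma>)
  let ?M = "add_mset (Box (Atom a) B) (image_mset (Dia (Atom a)) As)"
  have "F \<notin># ?M" using assms(3) by auto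
  then have "?M \<subseteq># \<Gamma>"
    using Gen by (metis add_mset_remove_trivial diff_single_trivial subset_eq_diff_conv
        add_mset_add_single)
  then have "?M \<subseteq># \<Delta> + \<Gamma>" "?M \<subseteq># \<Delta>' + \<Gamma>"
    by (meson mset_subset_eq_add_right subset_mset.order_trans)+
  then show ?case using Gen G3.Gen by blast
qed

text \<open>A decomposition can introduce two formulas at once, so contraction is lifted to
  multisets at unchanged height.\<close>

lemma contract_mset:
  assumes "\<And>F \<Gamma>. G3 n (add_mset F (add_mset F \<Gamma>)) \<Longrightarrow> G3 n (add_mset F \<Gamma>)"
  shows "G3 n (\<Delta> + \<Delta> + \<Gamma>) \<Longrightarrow> G3 n (\<Delta> + \<Gamma>)"
proof (induction \<Delta> arbitrary: \<Gamma>)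
  case (add F \<Delta>)
  have "G3 n (\<Delta> + \<Delta> + add_mset F \<Gamma>)" using add.prems assms by simp
  then show ?case using add.IH by fastforce
qed simp

text \<open>Induction on the height alone suffices, for all formulas at once: when \<open>F\<close>
  is decomposed, its other copy is inverted in the premises, and the resulting duplicates are
  contracted at the smaller height \<open>n\<close>.\<close>

lemma G3_contract: "G3 n (add_mset F (add_mset F \<Gamma>)) \<Longrightarrow> G3 n (add_mset F \<Gamma>)"
proof (induction n arbitrary: F \<Gamma>)
  case 0
  then show ?case by cases (auto intro: G3.Ax)
next
  case (Suc n)
  note contract = contract_mset[OF Suc.IH]
  from Suc.prems show ?case
  proof cases
    case (Ax x)
    then show ?thesis by (auto intro: G3.Ax)
  next
    case (Dec F1 \<Delta> \<Delta>' \<Gamma>1)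
    show ?thesis
    proof (cases "F1 = F")
      case True
      then have "\<Gamma>1 = add_mset F \<Gamma>" using Dec by simp
      then have "G3 n (\<Delta> + (\<Delta> + \<Gamma>))" "G3 n (\<Delta>' + (\<Delta>' + \<Gamma>))"
        using G3_invert[OF Dec(3), of F "\<Delta> + \<Gamma>"] G3_invert[OF Dec(4), of F "\<Delta>' + \<Gamma>"] Dec(2) True by auto
      then have "G3 n (\<Delta> + \<Gamma>)" "G3 n (\<Delta>' + \<Gamma>)" using contract by (simp_all add: add.assoc)
      then show ?thesis using G3.Dec Dec(2) True by blast
    next
      case False
      then obtain K where K: "\<Gamma>1 = add_mset F K" "add_mset F \<Gamma> = add_mset F1 K"
        using Dec(1) by (auto simp: add_eq_conv_ex)
      then obtain L where L: "K = add_mset F L" "\<Gamma> = add_mset F1 L"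
        using False by (auto simp: add_eq_conv_ex)
      have "G3 n (\<Delta> + add_mset F L)" "G3 n (\<Delta>' + add_mset F L)"
        using Dec K L Suc.IH by auto
      then show ?thesis using G3.Dec[OF Dec(2)] L by (simp add: add_mset_commute)
    qed
  next
    case (Star P m A \<Gamma>1)
    let ?S = "Dia (Star P) A"
    show ?thesis
    proof (cases "?S = F")
      case True
      then have "\<Gamma>1 = add_mset F \<Gamma>" using Star(1) by simp
      then have "G3 n (add_mset F (add_mset F (add_mset ((Dia P ^^ m) A) \<Gamma>)))"
        using Star(2) True by (simp add: add_mset_commute)
      then have "G3 n (add_mset ((Dia P ^^ m) A) (add_mset F \<Gamma>))"
        using Suc.IH by (simp add: add_mset_commute)
      then show ?thesis using True G3.Star by blast
    next
      case False
      then obtain K where K: "\<Gamma>1 = add_mset F K" "add_mset F \<Gamma> = add_mset ?S K"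
        using Star(1) by (auto simp: add_eq_conv_ex)
      then obtain L where L: "K = add_mset F L" "\<Gamma> = add_mset ?S L"
        using False by (auto simp: add_eq_conv_ex)
      have "G3 n (add_mset F (add_mset F (add_mset ((Dia P ^^ m) A) (add_mset ?S L))))"
        using Star(2) K L by (simp add: add_mset_commute)
      then have "G3 n (add_mset ((Dia P ^^ m) A) (add_mset ?S (add_mset F L)))"
        using Suc.IH by (simp add: add_mset_commute)
      then show ?thesis using G3.Star[of n m P A "add_mset F L"] L by (simp add: add_mset_commute)
    qed
  next
    case (Gen B As a)
    let ?M = "add_mset (Box (Atom a) B) (image_mset (Dia (Atom a)) As)"
    show ?thesis
    \<comment> \<open>If the inference uses at most one copy of \<open>F\<close>, the one left after
      contraction is enough.\<close>
    proof (cases "count ?M F \<le> 1")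
      case True
      have "?M \<subseteq># add_mset F \<Gamma>"
      proof (rule mset_subset_eqI)
        fix x
        show "count ?M x \<le> count (add_mset F \<Gamma>) x"
          using mset_subset_eq_count[OF Gen(2), of x] True by (cases "x = F") auto
      qed
      then show ?thesis using Gen G3.Gen by blast
    next
      case False
      \<comment> \<open>Two used copies must be diamonds, since the box occurs only once. They come
        from two copies of the same \<open>A\<close> in the premise, where contraction
        applies.\<close>
      then have "F \<noteq> Box (Atom a) B"
        by (auto simp: count_eq_zero_iff)
      then have c: "count (image_mset (Dia (Atom a)) As) F \<ge> 2" using False by simp
      then obtain N where N: "image_mset (Dia (Atom a)) As = add_mset F N"
        by (metis count_eq_zero_iff mset_add not_numeral_le_zero)
      then obtain A As1 where 1: "As = add_mset A As1" "Dia (Atom a) A = F"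
          "image_mset (Dia (Atom a)) As1 = N"
        by (metis msed_map_invR)
      have "F \<in># N" using c N by (simp flip: count_greater_zero_iff)
      then obtain N' where "N = add_mset F N'" by (metis mset_add)
      then obtain A' As2 where 2: "As1 = add_mset A' As2" "Dia (Atom a) A' = F"
        using 1(3) by (metis msed_map_invR)
      then have As: "As = add_mset A (add_mset A As2)" using 1 by auto
      have "G3 n (add_mset B (add_mset A As2))"
        using Gen(1) As Suc.IH by (metis add_mset_commute)
      moreover have "add_mset (Box (Atom a) B) (image_mset (Dia (Atom a)) (add_mset A As2)) \<subseteq># add_mset F \<Gamma>"
        using Gen(2) As 1(2)
          add_mset_commute[of "Box (Atom a) B" F "add_mset F (image_mset (Dia (Atom a)) As2)"]
        by simp
      ultimately show ?thesis by (rule G3.Gen)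
    qed
  qed
qed

text \<open>Weakening by \<open>\<Delta>\<close> doubles every formula of \<open>\<Gamma>\<close>
  with one in \<open>\<Delta>\<close>, and contraction then removes \<open>\<Gamma>\<close>. So
  derivability depends only on the set of formulas.\<close>

lemma G3_set_mset:
  assumes "G3 n \<Gamma>" "set_mset \<Gamma> \<subseteq> set_mset \<Delta>"
  shows "G3 n \<Delta>"
proof -
  have "G3 n (\<Gamma> + \<Delta>)" using assms(1) G3_weaken by blast
  then show ?thesis using assms(2)
  proof (induction \<Gamma>)
    case (add F \<Gamma>)
    then obtain \<Delta>' where "\<Delta> = add_mset F \<Delta>'" by (metis insert_subset mset_add set_mset_add_mset_insert)
    then show ?case using add G3_contract[of n F "\<Gamma> + \<Delta>'"] by simp
  qed simp
qed

section \<open>Embedding of \<open>G3\<close> into \<open>SEQ_1\<close>\<close>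

lemma SEQ_1_rules: "r \<in> SEQ_1 \<longleftrightarrow> r \<noteq> BoxStar \<and> r \<noteq> Cut"
  by (auto simp: SEQ_1_def SEQ_omega_def)

text \<open>The coefficients 1, 0, ..., 0 select one box followed by diamonds, the form in which
  \<open>G3\<close> uses (Gen).\<close>

lemma map2_modal_Box_Dia:
  "map2 (modal P) (1 # replicate (length As) 0) (B # As) = Box P B # map (Dia P) As"
proof -
  have "map2 (modal P) (replicate (length As) 0) As = map (Dia P) As"
    by (induction As) (auto simp: modal_def)
  then show ?thesis by (simp add: modal_def)
qed

lemma G3_derivable: "G3 n \<Gamma> \<Longrightarrow> derivable SEQ_1 \<Gamma>"
proof (induction rule: G3.induct)
  case (Ax x \<Gamma> n)
  then obtain \<Gamma>1 where 1: "\<Gamma> = add_mset (PosLit x) \<Gamma>1" by (metis mset_add)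
  then have "NegLit x \<in># \<Gamma>1" using Ax by auto
  then obtain \<Gamma>2 where "\<Gamma> = {#PosLit x, NegLit x#} + \<Gamma>2"
    using 1 by (metis add_mset_add_single mset_add union_mset_add_mset_left add_0)
  then show ?case using inference.Ax[of x \<Gamma>2] derivable_inference[of rule.Ax]
    by (fastforce simp: SEQ_1_rules)
next
  case (Dec F \<Delta> \<Delta>' n \<Gamma>)
  have "\<exists>r\<in>SEQ_1. \<exists>p. inference r p ({#F#} + \<Gamma>) \<and> ran p \<subseteq> {\<Delta> + \<Gamma>, \<Delta>' + \<Gamma>}"
    using Dec(1)
  proof (cases F rule: dec.cases)
    case (1 A B)
    then show ?thesis using inference.OrR[of A B \<Gamma>] Dec(1) 
      by (intro bexI[of _ OrR] exI[of _ "[0 \<mapsto> {#A, B#} + \<Gamma>]"]) (auto simp: SEQ_1_rules)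
  next
    case (2 A B)
    then show ?thesis using inference.AndR[of A \<Gamma> B] Dec(1) 
      by (intro bexI[of _ AndR] exI[of _ "[0 \<mapsto> {#A#} + \<Gamma>, 1 \<mapsto> {#B#} + \<Gamma>]"]) (auto simp: SEQ_1_rules ran_def)
  next
    case (3 P R A)
    then show ?thesis using inference.DiaChoice[of P A R \<Gamma>] Dec(1) 
      by (intro bexI[of _ DiaChoice] exI[of _ "[0 \<mapsto> {#Dia P A, Dia R A#} + \<Gamma>]"]) (auto simp: SEQ_1_rules)
  next
    case (4 P R A)
    then show ?thesis using inference.BoxChoice[of P A \<Gamma> R] Dec(1) 
      by (intro bexI[of _ BoxChoice] exI[of _ "[0 \<mapsto> {#Box P A#} + \<Gamma>, 1 \<mapsto> {#Box R A#} + \<Gamma>]"])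
        (auto simp: SEQ_1_rules ran_def)
  next
    case (5 P R A)
    then show ?thesis using inference.DiaComp[of P R A \<Gamma>] Dec(1) 
      by (intro bexI[of _ DiaComp] exI[of _ "[0 \<mapsto> {#Dia P (Dia R A)#} + \<Gamma>]"]) (auto simp: SEQ_1_rules)
  next
    case (6 P R A)
    then show ?thesis using inference.BoxComp[of P R A \<Gamma>] Dec(1) 
      by (intro bexI[of _ BoxComp] exI[of _ "[0 \<mapsto> {#Box P (Box R A)#} + \<Gamma>]"]) (auto simp: SEQ_1_rules)
  qed auto
  then obtain r p where r: "inference r p ({#F#} + \<Gamma>)" "r \<in> SEQ_1" "ran p \<subseteq> {\<Delta> + \<Gamma>, \<Delta>' + \<Gamma>}"
    by blast
  have "derivable SEQ_1 ({#F#} + \<Gamma>)"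
  proof (rule derivable_inference[OF r(1,2)])
    fix i \<Sigma> assume "p i = Some \<Sigma>"
    then show "derivable SEQ_1 \<Sigma>"
      using r(3) Dec.IH by (auto dest: ranI)
  qed
  then show ?case by simp
next
  case (Star n P m A \<Gamma>)
  have "inference DiaStar [0 \<mapsto> add_mset ((Dia P ^^ m) A) (add_mset (Dia (Star P) A) \<Gamma>)]
      (add_mset (Dia (Star P) A) \<Gamma>)"
    using inference.DiaStar[where Qs = "[]" and P = P and m = m and A = A and \<Gamma> = \<Gamma>] by simp
  then show ?case
    by (rule derivable_inference) (use Star in \<open>auto simp: SEQ_1_rules split: if_splits\<close>)
next
  case (Gen n B As a \<Gamma>)
  obtain Bs where Bs: "mset Bs = As" by (metis ex_mset)
  obtain \<Pi> where \<Pi>: "\<Gamma> = add_mset (Box (Atom a) B) (image_mset (Dia (Atom a)) As) + \<Pi>"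
    using Gen.hyps by (metis mset_subset_eq_exists_conv)
  have "inference rule.Gen [0 \<mapsto> mset (B # Bs)]
      (mset (map2 (modal (Atom a)) (1 # replicate (length Bs) 0) (B # Bs)) + \<Pi>)"
    by (rule inference.Gen) (auto simp: sum_list_replicate)
  then have "inference rule.Gen [0 \<mapsto> add_mset B As] \<Gamma>"
    unfolding map2_modal_Box_Dia using Bs \<Pi> by simp
  then show ?case
    by (rule derivable_inference) (use Gen in \<open>auto simp: SEQ_1_rules split: if_splits\<close>)
qed

section \<open>Completeness\<close>

text \<open>Formulas in a consistent set are to be made false.  Multiplicities in \<open>\<Gamma>\<close> are not bounded, which
  makes consistency a property of finite character of the set alone.\<close>

definition consistent :: "fml set \<Rightarrow> bool" where
  "consistent S \<longleftrightarrow> (\<forall>n \<Gamma>. set_mset \<Gamma> \<subseteq> S \<longrightarrow> \<not> G3 n \<Gamma>)"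

text \<open>A finite multiset over the union of a nonempty chain already lies over one
  member.\<close>

lemma consistent_Union_chain:
  assumes "subset.chain {S. consistent S} C" "C \<noteq> {}"
  shows "consistent (\<Union>C)"
  unfolding consistent_def
proof (intro allI impI notI)
  fix n \<Gamma> assume "set_mset \<Gamma> \<subseteq> \<Union>C" "G3 n \<Gamma>"
  then obtain S where "S \<in> C" "set_mset \<Gamma> \<subseteq> S"
    using finite_subset_Union_chain[OF finite_set_mset _ assms(2,1)] by blast
  then show False using assms(1) \<open>G3 n \<Gamma>\<close> by (auto simp: subset_chain_def consistent_def)
qed

section \<open>Maximal consistent sets\<close>

definition maximal :: "fml set \<Rightarrow> bool" where
  "maximal S \<longleftrightarrow> consistent S \<and> (\<forall>T. consistent T \<longrightarrow> S \<subseteq> T \<longrightarrow> T = S)"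

lemma maximal_extension:
  assumes "consistent S"
  shows "\<exists>T. S \<subseteq> T \<and> maximal T"
proof -
  let ?C = "{T. S \<subseteq> T \<and> consistent T}"
  obtain T where T: "T \<in> ?C" "\<And>X. X \<in> ?C \<Longrightarrow> T \<subseteq> X \<Longrightarrow> X = T"
  proof (rule bexE[OF subset_Zorn_nonempty[of ?C]])
    show "?C \<noteq> {}" using assms by blast
  next
    fix C assume C: "C \<noteq> {}" "subset.chain ?C C"
    then have "subset.chain {T. consistent T} C" by (auto simp: subset_chain_def)
    then have "consistent (\<Union>C)" using C(1) by (rule consistent_Union_chain)
    moreover obtain T where "T \<in> C" "S \<subseteq> T" using C by (auto simp: subset_chain_def)
    ultimately show "\<Union>C \<in> ?C" by blast
  qed blast
  have "maximal T" using T by (simp add: maximal_def) (meson order_trans)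
  then show ?thesis using T(1) by blast
qed

text \<open>A membership criterion: testing one copy of \<open>\<Delta>\<close> against multisets
  over \<open>S\<close> suffices, since multiplicities are immaterial by
  \<open>G3_set_mset\<close>.\<close>

lemma maximal_mset_subset:
  assumes "maximal S" "\<And>n \<Gamma>. set_mset \<Gamma> \<subseteq> S \<Longrightarrow> \<not> G3 n (\<Delta> + \<Gamma>)"
  shows "set_mset \<Delta> \<subseteq> S"
proof -
  have "consistent (S \<union> set_mset \<Delta>)"
    unfolding consistent_def
  proof (intro allI impI notI)
    fix n \<Gamma> assume \<Gamma>: "set_mset \<Gamma> \<subseteq> S \<union> set_mset \<Delta>" "G3 n \<Gamma>"
    let ?\<Gamma> = "filter_mset (\<lambda>A. A \<in> S) \<Gamma>"
    have "G3 n (\<Delta> + ?\<Gamma>)" by (rule G3_set_mset[OF \<Gamma>(2)]) (use \<Gamma>(1) in auto)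
    then show False using assms(2)[of ?\<Gamma> n] by auto
  qed
  then show ?thesis using assms(1) unfolding maximal_def by blast
qed

text \<open>Membership stands for falsity, so the two premises become alternatives. If both failed,
  two derivations would combine into one of a multiset over \<open>S\<close>.\<close>

lemma maximal_dec:
  assumes S: "maximal S" and F: "F \<in> S" "dec F = Some (\<Delta>, \<Delta>')"
  shows "set_mset \<Delta> \<subseteq> S \<or> set_mset \<Delta>' \<subseteq> S"
proof (rule ccontr)
  assume "\<not> ?thesis"
  then obtain n \<Gamma> n' \<Gamma>' where 1: "set_mset \<Gamma> \<subseteq> S" "G3 n (\<Delta> + \<Gamma>)"
    and 2: "set_mset \<Gamma>' \<subseteq> S" "G3 n' (\<Delta>' + \<Gamma>')"
    using maximal_mset_subset[OF S] by meson
  \<comment> \<open>Weakening and the maximum of the indices give both premises the same context and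
    height bound.\<close>
  let ?m = "max n n'"
  have "G3 ?m (\<Delta> + (\<Gamma> + \<Gamma>'))" "G3 ?m (\<Delta>' + (\<Gamma> + \<Gamma>'))"
    using G3_mono[OF _ G3_weaken[OF 1(2), of \<Gamma>'], of ?m] G3_mono[OF _ G3_weaken[OF 2(2), of \<Gamma>], of ?m]
    by (simp_all add: ac_simps)
  then have "G3 (Suc ?m) (add_mset F (\<Gamma> + \<Gamma>'))" using G3.Dec F(2) by blast
  moreover have "set_mset (add_mset F (\<Gamma> + \<Gamma>')) \<subseteq> S" using 1 2 F(1) by auto
  ultimately show False using S unfolding maximal_def consistent_def by blast
qed

lemma maximal_Dia_Star:
  assumes S: "maximal S" and F: "Dia (Star P) A \<in> S"
  shows "(Dia P ^^ m) A \<in> S"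
proof -
  have "set_mset {#(Dia P ^^ m) A#} \<subseteq> S"
  proof (rule maximal_mset_subset[OF S], rule notI)
    fix n \<Gamma> assume \<Gamma>: "set_mset \<Gamma> \<subseteq> S" "G3 n ({#(Dia P ^^ m) A#} + \<Gamma>)"
    then have "G3 n (add_mset ((Dia P ^^ m) A) (add_mset (Dia (Star P) A) \<Gamma>))"
      using G3_weaken[of n _ "{#Dia (Star P) A#}"] by (simp add: add_mset_commute)
    then have "G3 (Suc n) (add_mset (Dia (Star P) A) \<Gamma>)" by (rule G3.Star)
    moreover have "set_mset (add_mset (Dia (Star P) A) \<Gamma>) \<subseteq> S" using \<Gamma> F by auto
    ultimately show False using S unfolding maximal_def consistent_def by blast
  qed
  then show ?thesis by simp
qed

text \<open>This is (Gen) read upwards: at a successor witnessing the falsity of the box,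
  \<open>B\<close> must fail together with the body of every false diamond of the same atomic
  program.\<close>

lemma consistent_Gen:
  assumes S: "consistent S" and F: "Box (Atom a) B \<in> S"
  shows "consistent (insert B {A. Dia (Atom a) A \<in> S})"
  unfolding consistent_def
proof (intro allI impI notI)
  fix n \<Gamma> assume \<Gamma>: "set_mset \<Gamma> \<subseteq> insert B {A. Dia (Atom a) A \<in> S}" "G3 n \<Gamma>"
  let ?As = "filter_mset (\<lambda>A. Dia (Atom a) A \<in> S) \<Gamma>"
  have "G3 n (add_mset B ?As)" by (rule G3_set_mset[OF \<Gamma>(2)]) (use \<Gamma>(1) in auto)
  then have "G3 (Suc n) (add_mset (Box (Atom a) B) (image_mset (Dia (Atom a)) ?As))"
    using subset_mset.order_refl by (rule G3.Gen)
  moreover have "set_mset (add_mset (Box (Atom a) B) (image_mset (Dia (Atom a)) ?As)) \<subseteq> S"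
    using F by auto
  ultimately show False using S unfolding consistent_def by blast
qed

text \<open>Worlds are paths from the root; a path lists, latest first, the boxes whose falsity each step
  witnesses.  Unlike the set of all maximal sets, the set of paths is countable and hence embeds
  into every infinite type.\<close>

primrec label :: "fml set \<Rightarrow> (nat \<times> fml) list \<Rightarrow> fml set" where
  "label S [] = S"
| "label S (s # w) = (case s of (a, B) \<Rightarrow>
    if Box (Atom a) B \<in> label S w
    then SOME T. insert B {A. Dia (Atom a) A \<in> label S w} \<subseteq> T \<and> maximal T
    else label S w)"

lemma label_step:
  assumes "maximal (label S w)" "Box (Atom a) B \<in> label S w"
  shows "insert B {A. Dia (Atom a) A \<in> label S w} \<subseteq> label S ((a, B) # w) \<and> maximal (label S ((a, B) # w))"
proof -
  have "consistent (label S w)" using assms(1) by (simp add: maximal_def)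
  then have "\<exists>T. insert B {A. Dia (Atom a) A \<in> label S w} \<subseteq> T \<and> maximal T"
    by (rule maximal_extension[OF consistent_Gen[OF _ assms(2)]])
  from someI_ex[OF this] show ?thesis using assms(2) by simp
qed

text \<open>Where a step is not justified by a box, \<open>label\<close> copies the parent's label,
  so every path gets a maximal label.\<close>

lemma maximal_label: "maximal S \<Longrightarrow> maximal (label S w)"
proof (induction w)
  case (Cons s w)
  then show ?case using label_step[of S w] by (cases s; cases "Box (Atom (fst s)) (snd s) \<in> label S w") auto
qed simp

text \<open>The map \<open>e\<close> transports paths to states. For injective \<open>e\<close>, a
  path whose latest step is not justified by a box has no incoming edge.\<close>

definition tree_model :: "((nat \<times> fml) list \<Rightarrow> 'w) \<Rightarrow> fml set \<Rightarrow> 'w kripke" where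
  "tree_model e S = \<lparr>states = range e,
    acc = (\<lambda>a. {(e w, e ((a, B) # w)) |w B. Box (Atom a) B \<in> label S w}),
    val = (\<lambda>x. e ` {w. PosLit x \<notin> label S w})\<rparr>"

lemma kripke_tree_model: "kripke_model (tree_model e S)"
  by (auto simp: kripke_model_def tree_model_def)

context
  fixes e :: "(nat \<times> fml) list \<Rightarrow> 'w" and S :: "fml set"
  assumes e: "inj e" and S: "maximal S"
begin

text \<open>Intermediate states of compositions and iterations are again paths, so induction
  hypotheses about labels apply to them.\<close>

lemma tree_model_reaches:
  assumes "(e w, v) \<in> prog_rel (tree_model e S) P"
  obtains w' where "v = e w'"
  using prog_rel_states[OF kripke_tree_model assms] by (auto simp: tree_model_def)

lemmas max_label = maximal_label[OF S]

lemma label_Dia: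
  "Dia P A \<in> label S w \<Longrightarrow> (e w, e w') \<in> prog_rel (tree_model e S) P \<Longrightarrow> A \<in> label S w'"
proof (induction P arbitrary: A w w')
  case (Atom a)
  then obtain B where "w' = (a, B) # w" "Box (Atom a) B \<in> label S w"
    using e by (auto simp: tree_model_def inj_eq)
  then show ?case using label_step[OF max_label] Atom by blast
next
  case (Comp P Q)
  from Comp.prems(2) obtain v where v: "(e w, v) \<in> prog_rel (tree_model e S) P"
    "(v, e w') \<in> prog_rel (tree_model e S) Q" by auto
  moreover obtain w1 where "v = e w1" using v(1) tree_model_reaches by blast
  moreover have "Dia P (Dia Q A) \<in> label S w"
    using maximal_dec[OF max_label Comp.prems(1)] by simp
  ultimately show ?case using Comp.IH by blast
next
  case (Choice P Q)
  have "Dia P A \<in> label S w" "Dia Q A \<in> label S w"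
    using maximal_dec[OF max_label Choice.prems(1)] by simp_all
  moreover have "(e w, e w') \<in> prog_rel (tree_model e S) P \<or> (e w, e w') \<in> prog_rel (tree_model e S) Q"
    using Choice.prems(2) by simp
  ultimately show ?case using Choice.IH by blast
next
  case (Star P)
  have "(e w, e w') \<in> (prog_rel (tree_model e S) P)\<^sup>*" using Star.prems(2) by simp
  then obtain m where "(e w, e w') \<in> prog_rel (tree_model e S) P ^^ m"
    using rtrancl_imp_relpow by blast
  moreover have "(Dia P ^^ m) A \<in> label S w"
    using maximal_Dia_Star[OF max_label Star.prems(1)] .
  ultimately show ?case
  \<comment> \<open>Each step along \<open>P\<close> strips one diamond, by the induction hypothesis
    for the program \<open>P\<close>.\<close>
  proof (induction m arbitrary: w)
    case 0
    then show ?case using e by (auto simp: inj_eq)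
  next
    case (Suc m)
    then obtain v where v: "(e w, v) \<in> prog_rel (tree_model e S) P"
      "(v, e w') \<in> prog_rel (tree_model e S) P ^^ m" by (meson relpow_Suc_D2)
    moreover obtain w1 where "v = e w1" using v(1) tree_model_reaches by blast
    moreover have "Dia P ((Dia P ^^ m) A) \<in> label S w" using Suc.prems by simp
    ultimately show ?case using Suc.IH Star.IH by blast
  qed
qed

text \<open>Star-freeness leaves only programs whose boxes are atomic or decomposed by
  \<open>dec\<close>; \<open>G3\<close> has no rule with a starred box as principal formula.\<close>

lemma label_Box:
  "star_free P \<Longrightarrow> Box P A \<in> label S w \<Longrightarrow>
    \<exists>w'. (e w, e w') \<in> prog_rel (tree_model e S) P \<and> A \<in> label S w'"
proof (induction P arbitrary: A w)
  case (Atom a)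
  then have "A \<in> label S ((a, A) # w)" using label_step[OF max_label] by blast
  then show ?case using Atom by (auto simp: tree_model_def simp del: label.simps)
next
  case (Comp P Q)
  have "Box P (Box Q A) \<in> label S w"
    using maximal_dec[OF max_label Comp.prems(2)] by simp
  then show ?case using Comp by (simp add: relcomp_unfold) blast
next
  case (Choice P Q)
  have "Box P A \<in> label S w \<or> Box Q A \<in> label S w"
    using maximal_dec[OF max_label Choice.prems(2)] by simp
  then show ?case using Choice.IH Choice.prems(1) by simp blast
qed auto

text \<open>Positive literals fail by the choice of the valuation, negative ones because
  complementary literals in one label would form an axiom.\<close>

lemma label_not_holds:
  "box_star_free A \<Longrightarrow> A \<in> label S w \<Longrightarrow> \<not> holds (tree_model e S) (e w) A"
proof (induction A arbitrary: w)
  case (PosLit x)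
  then show ?case using e by (auto simp: tree_model_def inj_eq)
next
  case (NegLit x)
  have "consistent (label S w)" using max_label by (simp add: maximal_def)
  moreover have "G3 0 {#PosLit x, NegLit x#}" by (rule G3.Ax[of x]) auto
  ultimately have "PosLit x \<notin> label S w"
    using NegLit unfolding consistent_def by fastforce
  then show ?case by (auto simp: tree_model_def)
next
  case (Or A B)
  then show ?case using maximal_dec[OF max_label Or.prems(2)] by auto
next
  case (And A B)
  then show ?case using maximal_dec[OF max_label And.prems(2)] by auto
next
  case (Box P A)
  then show ?case using label_Box by fastforce
next
  case (Dia P A)
  then show ?case using label_Dia tree_model_reaches by (metis box_star_free.simps(6) holds.simps(6))
qed

end

section \<open>Countermodels over any infinite type\<close>

instance prog :: countable by countable_datatype
instance fml :: countable by countable_datatype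

text \<open>Validity over a single infinite type suffices: paths are coded by natural numbers, which
  embed into \<open>'w\<close>, so the tree model lives there.\<close>

lemma completeness:
  assumes "\<forall>A\<in>#\<Gamma>. box_star_free A"
    and valid: "\<And>(M :: 'w::infinite kripke) u. kripke_model M \<Longrightarrow> u \<in> states M \<Longrightarrow> \<exists>A\<in>#\<Gamma>. holds M u A"
  shows "derivable SEQ_1 \<Gamma>"
proof (rule ccontr)
  assume "\<not> derivable SEQ_1 \<Gamma>"
  then have "consistent (set_mset \<Gamma>)"
    using G3_set_mset G3_derivable unfolding consistent_def by blast
  then obtain S where S: "set_mset \<Gamma> \<subseteq> S" "maximal S" using maximal_extension by blast
  obtain f :: "nat \<Rightarrow> 'w" where "inj f"
    using infinite_countable_subset[OF infinite_UNIV] by blast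
  then have e: "inj (f \<circ> to_nat :: (nat \<times> fml) list \<Rightarrow> 'w)" (is "inj ?e")
    by (simp add: inj_compose)
  obtain A where "A \<in># \<Gamma>" "holds (tree_model ?e S) (?e []) A"
    using valid[OF kripke_tree_model, of "?e []" ?e S] by (auto simp: tree_model_def)
  then show False using label_not_holds[OF e S(2), of A "[]"] S(1) assms(1) by auto
qed

theorem corollary9:
  shows "(\<forall>\<Gamma> :: sequent. (\<forall>A \<in># \<Gamma>. box_star_free A) \<longrightarrow> derivable SEQ_omega \<Gamma> \<longrightarrow> derivable SEQ_1 \<Gamma>)
    \<and> (\<forall>t. derivation SEQ_1 t \<longrightarrow> finite_tree t)
    \<and> (\<forall>A. box_star_free A \<longrightarrow> (valid TYPE('w::infinite) A \<longleftrightarrow> derivable SEQ_1 {#A#}))"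
proof (intro conjI allI impI iffI)
  fix \<Gamma> assume "\<forall>A\<in>#\<Gamma>. box_star_free A" "derivable SEQ_omega \<Gamma>"
  \<comment> \<open>Cut and the \<omega>-rule are eliminated semantically, by soundness followed by
    completeness; \<open>nat\<close> serves as a fixed infinite type of states.\<close>
  then show "derivable SEQ_1 \<Gamma>"
    by (intro completeness[where 'w = nat]) (auto simp: derivable_def dest: derivation_sound)
next
  fix t assume "derivation SEQ_1 t"
  then show "finite_tree t" by (rule derivation_finite) (simp add: SEQ_1_rules)
next
  fix A assume "box_star_free A" "valid TYPE('w) A"
  then show "derivable SEQ_1 {#A#}"
    by (intro completeness[where 'w = 'w]) (auto simp: valid_def)
next
  fix A assume "derivable SEQ_1 {#A#}"
  then show "valid TYPE('w) A"
    unfolding valid_def derivable_def by (metis derivation_sound set_mset_single singletonD)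
qed

end
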